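(* Let $(\mathcal H,s,t,\Delta,\varepsilon,S)$ be a commutative Hopf algebroid over a commutative $\Bbbk$-algebra $A$, where $\Bbbk$ is a field of characteristic $0$. Then the set $\mathfrak{Brt}(\mathcal H,A)$ of local biretractions of $\mathcal H$, with the convolution product $$(\alpha\ast\beta)(h)=\beta\big(t(\alpha(h_{(1)}))\,h_{(2)}\big)=\beta(t(\alpha(h_{(1)})))\,\beta(h_{(2)}),\qquad h\in\mathcal H,$$ is a regular monoid.
   Context: Commutative Hopf algebroid over $A$: commutative unital $\Bbbk$-algebras $\mathcal H$ and $A$ with unital algebra morphisms $s,t:A\to\mathcal H$ (source and target). $\mathcal H$ is an $A$-bimodule by $a\triangleright h\triangleleft b=t(a)\,h\,s(b)$, and $\mathcal H\otimes_A\mathcal H$ is formed accordingly, so that $h\,s(a)\otimes_A k=h\otimes_A t(a)\,k$. There are $A$-bimodule maps $\Delta:\mathcal H\to\mathcal H\otimes_A\mathcal H$, $\Delta(h)=h_{(1)}\otimes_A h_{(2)}$, and $\varepsilon:\mathcal H\to A$ which are unital algebra morphisms, with $\Delta$ coassociative and $t(\varepsilon(h_{(1)}))h_{(2)}=h=h_{(1)}s(\varepsilon(h_{(2)}))$; in particular $\varepsilon\circ s=\varepsilon\circ t=\mathrm{id}_A$. The antipode $S:\mathcal H\to\mathcal H$ is an algebra morphism with $S\circ s=t$, $S\circ t=s$, $S(h_{(1)})h_{(2)}=s(\varepsilon(h))$ and $h_{(1)}S(h_{(2)})=t(\varepsilon(h))$ for all $h\in\mathcal H$. Local biretraction: a $\Bbbk$-linear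 and multiplicative (not necessarily unital) map $\alpha:\mathcal H\to A$ such that (BRT1) $\alpha(s(a))=a\,\alpha(1_{\mathcal H})$ for every $a\in A$; (BRT2) there exists $e^\alpha\in A$ such that $\alpha(t(e^\alpha))=\alpha(1_{\mathcal H})$ and $\alpha\circ t|_{Ae^\alpha}:Ae^\alpha\to A\,\alpha(1_{\mathcal H})$ is a bijection. A monoid $M$ is regular if each $x\in M$ has a pseudo-inverse, i.e. an element $x^*\in M$ with $xx^*x=x$ and $x^*xx^*=x^*$. *)

theory Defs
  imports Complex_Main "HOL-Algebra.Free_Abelian_Groups" "HOL-Algebra.Ring"
begin

section \<open>Commutative algebras over a field\<close>

text \<open>
  The sort \<open>{comm_ring, comm_monoid_mult}\<close> is that of commutative unital rings in which
  \<open>0 = 1\<close> is permitted (\<^class>\<open>comm_ring_1\<close> would exclude the zero algebra).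
\<close>

locale comm_algebra = vector_space scale
  for scale :: "'k::field \<Rightarrow> 'a::{comm_ring, comm_monoid_mult} \<Rightarrow> 'a" +
  assumes scale_mult_left: "scale c (x * y) = scale c x * y"

definition algebra_morphism ::
  "('k::field \<Rightarrow> 'a::{comm_ring, comm_monoid_mult} \<Rightarrow> 'a) \<Rightarrow>
   ('k \<Rightarrow> 'b::{comm_ring, comm_monoid_mult} \<Rightarrow> 'b) \<Rightarrow> ('a \<Rightarrow> 'b) \<Rightarrow> bool" where
  "algebra_morphism scA scB f \<longleftrightarrow>
     Vector_Spaces.linear scA scB f \<and> (\<forall>x y. f (x * y) = f x * f y) \<and> f 1 = 1"


section \<open>The tensor products \<open>H \<otimes>\<^sub>A H\<close> and \<open>H \<otimes>\<^sub>A H \<otimes>\<^sub>A H\<close>\<close>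

text \<open>
  \<open>H \<otimes>\<^sub>A H\<close> is the free abelian group on \<open>H \<times> H\<close> modulo the subgroup generated by the
  biadditivity relators and the relators \<open>h s(a) \<otimes> k - h \<otimes> t(a) k\<close>; its elements are
  cosets of formal sums.  Bilinearity over the ground field need not be imposed
  separately: multiplication by a scalar \<open>c\<close> on \<open>H\<close> is multiplication by
  \<open>s(c 1) = t(c 1)\<close>.
\<close>

definition tensor2_relators ::
  "('a \<Rightarrow> 'h::{comm_ring, comm_monoid_mult}) \<Rightarrow> ('a \<Rightarrow> 'h) \<Rightarrow> ('h \<times> 'h \<Rightarrow>\<^sub>0 int) set" where
  "tensor2_relators s t =
     {frag_of (x + x', y) - frag_of (x, y) - frag_of (x', y) |x x' y. True} \<union>
     {frag_of (x, y + y') - frag_of (x, y) - frag_of (x, y') |x y y'. True} \<union>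
     {frag_of (x * s a, y) - frag_of (x, t a * y) |x a y. True}"

definition tensor3_relators ::
  "('a \<Rightarrow> 'h::{comm_ring, comm_monoid_mult}) \<Rightarrow> ('a \<Rightarrow> 'h) \<Rightarrow> ('h \<times> 'h \<times> 'h \<Rightarrow>\<^sub>0 int) set" where
  "tensor3_relators s t =
     {frag_of (x + x', y, z) - frag_of (x, y, z) - frag_of (x', y, z) |x x' y z. True} \<union>
     {frag_of (x, y + y', z) - frag_of (x, y, z) - frag_of (x, y', z) |x y y' z. True} \<union>
     {frag_of (x, y, z + z') - frag_of (x, y, z) - frag_of (x, y, z') |x y z z'. True} \<union>
     {frag_of (x * s a, y, z) - frag_of (x, t a * y, z) |x a y z. True} \<union>
     {frag_of (x, y * s a, z) - frag_of (x, y, t a * z) |x y a z. True}"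

definition free_class :: "('x \<Rightarrow>\<^sub>0 int) set \<Rightarrow> ('x \<Rightarrow>\<^sub>0 int) \<Rightarrow> ('x \<Rightarrow>\<^sub>0 int) set" where
  "free_class R c = generate (free_Abelian_group UNIV) R #>\<^bsub>free_Abelian_group UNIV\<^esub> c"

abbreviation "tensor2_class s t \<equiv> free_class (tensor2_relators s t)"
abbreviation "tensor3_class s t \<equiv> free_class (tensor3_relators s t)"

definition frag_pair_mult ::
  "('h::times \<times> 'h \<Rightarrow>\<^sub>0 int) \<Rightarrow> ('h \<times> 'h \<Rightarrow>\<^sub>0 int) \<Rightarrow> ('h \<times> 'h \<Rightarrow>\<^sub>0 int)" where
  "frag_pair_mult c d =
     frag_extend (\<lambda>(x, y). frag_extend (\<lambda>(u, v). frag_of (x * u, y * v)) d) c"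

text \<open>
  The ring \<open>H \<otimes>\<^sub>A H\<close>.  As in \<^const>\<open>set_mult\<close>, operations on cosets are unions over all
  representatives; since the operations respect the relators, the union is a single coset.
\<close>

definition tensor_ring ::
  "('a \<Rightarrow> 'h::{comm_ring, comm_monoid_mult}) \<Rightarrow> ('a \<Rightarrow> 'h) \<Rightarrow> ('h \<times> 'h \<Rightarrow>\<^sub>0 int) set ring" where
  "tensor_ring s t =
     (let F = free_Abelian_group UNIV;
          Q = F Mod generate F (tensor2_relators s t)
      in \<lparr>carrier = carrier Q,
          monoid.mult = (\<lambda>X Y. \<Union>c\<in>X. \<Union>d\<in>Y. tensor2_class s t (frag_pair_mult c d)),
          one = tensor2_class s t (frag_of (1, 1)),
          zero = one Q,
          add = monoid.mult Q\<rparr>)"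

text \<open>The bimodule structure \<open>a \<triangleright> (h \<otimes> k) \<triangleleft> b = t(a) h \<otimes> k s(b)\<close>.\<close>

definition tensor_biaction ::
  "('a \<Rightarrow> 'h::{comm_ring, comm_monoid_mult}) \<Rightarrow> ('a \<Rightarrow> 'h) \<Rightarrow>
   'a \<Rightarrow> ('h \<times> 'h \<Rightarrow>\<^sub>0 int) set \<Rightarrow> 'a \<Rightarrow> ('h \<times> 'h \<Rightarrow>\<^sub>0 int) set" where
  "tensor_biaction s t a X b =
     (\<Union>c\<in>X. tensor2_class s t (frag_extend (\<lambda>(x, y). frag_of (t a * x, y * s b)) c))"

text \<open>
  The maps \<open>\<Delta> \<otimes> id\<close> and \<open>id \<otimes> \<Delta>\<close> from \<open>H \<otimes>\<^sub>A H\<close> to \<open>H \<otimes>\<^sub>A H \<otimes>\<^sub>A H\<close>, where \<open>r\<close> runs over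
  the choices of representatives of all \<open>\<Delta> h\<close>.  If \<open>\<Delta>\<close> is a bimodule map, the result
  depends neither on \<open>r\<close> nor on \<open>c\<close>.
\<close>

definition comult_tensor_id ::
  "('a \<Rightarrow> 'h::{comm_ring, comm_monoid_mult}) \<Rightarrow> ('a \<Rightarrow> 'h) \<Rightarrow> ('h \<Rightarrow> ('h \<times> 'h \<Rightarrow>\<^sub>0 int) set) \<Rightarrow>
   ('h \<times> 'h \<Rightarrow>\<^sub>0 int) set \<Rightarrow> ('h \<times> 'h \<times> 'h \<Rightarrow>\<^sub>0 int) set" where
  "comult_tensor_id s t \<Delta> X =
     (\<Union>c\<in>X. \<Union>r\<in>{r. \<forall>h. r h \<in> \<Delta> h}.
        tensor3_class s t
          (frag_extend (\<lambda>(x, y). frag_extend (\<lambda>(u, v). frag_of (u, v, y)) (r x)) c))"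

definition id_tensor_comult ::
  "('a \<Rightarrow> 'h::{comm_ring, comm_monoid_mult}) \<Rightarrow> ('a \<Rightarrow> 'h) \<Rightarrow> ('h \<Rightarrow> ('h \<times> 'h \<Rightarrow>\<^sub>0 int) set) \<Rightarrow>
   ('h \<times> 'h \<Rightarrow>\<^sub>0 int) set \<Rightarrow> ('h \<times> 'h \<times> 'h \<Rightarrow>\<^sub>0 int) set" where
  "id_tensor_comult s t \<Delta> X =
     (\<Union>c\<in>X. \<Union>r\<in>{r. \<forall>h. r h \<in> \<Delta> h}.
        tensor3_class s t
          (frag_extend (\<lambda>(x, y). frag_extend (\<lambda>(u, v). frag_of (x, u, v)) (r y)) c))"

text \<open>
  \<open>frag_sum scale f c\<close> is the value at the formal sum \<open>c\<close> of the additive extension of \<open>f\<close>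
  (integer coefficients act through the ground field), and \<open>tensor_eval scale f X\<close> is the
  value at the coset \<open>X\<close> of the induced map on the quotient, which is meaningful when
  \<open>f\<close> respects the relators.  So \<open>tensor_eval scale f (\<Delta> h)\<close> is the expression written
  \<open>f(h\<^sub>1, h\<^sub>2)\<close> in Sweedler notation.
\<close>

definition frag_sum ::
  "('k::field \<Rightarrow> 'b::ab_group_add \<Rightarrow> 'b) \<Rightarrow> ('x \<Rightarrow> 'b) \<Rightarrow> ('x \<Rightarrow>\<^sub>0 int) \<Rightarrow> 'b" where
  "frag_sum scale f c =
     (\<Sum>p\<in>Poly_Mapping.keys c. scale (of_int (Poly_Mapping.lookup c p)) (f p))"

definition tensor_eval ::
  "('k::field \<Rightarrow> 'b::ab_group_add \<Rightarrow> 'b) \<Rightarrow> ('x \<Rightarrow> 'b) \<Rightarrow> ('x \<Rightarrow>\<^sub>0 int) set \<Rightarrow> 'b" where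
  "tensor_eval scale f X = the_elem (frag_sum scale f ` X)"


section \<open>Commutative Hopf algebroids\<close>

locale comm_hopf_algebroid =
  H: comm_algebra scH + A: comm_algebra scA
  for scH :: "'k::field \<Rightarrow> 'h::{comm_ring, comm_monoid_mult} \<Rightarrow> 'h"
    and scA :: "'k \<Rightarrow> 'a::{comm_ring, comm_monoid_mult} \<Rightarrow> 'a" +
  fixes s t :: "'a \<Rightarrow> 'h"
    and \<Delta> :: "'h \<Rightarrow> ('h \<times> 'h \<Rightarrow>\<^sub>0 int) set"
    and \<epsilon> :: "'h \<Rightarrow> 'a"
    and S :: "'h \<Rightarrow> 'h"
  assumes source_morphism: "algebra_morphism scA scH s"
    and target_morphism: "algebra_morphism scA scH t"
    \<comment> \<open>linearity of \<open>\<Delta>\<close> over the ground field is contained in its \<open>A\<close>-linearity\<close>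
    and comult_closed: "\<Delta> h \<in> carrier (tensor_ring s t)"
    and comult_add: "\<Delta> (h + k) = \<Delta> h \<oplus>\<^bsub>tensor_ring s t\<^esub> \<Delta> k"
    and comult_mult: "\<Delta> (h * k) = \<Delta> h \<otimes>\<^bsub>tensor_ring s t\<^esub> \<Delta> k"
    and comult_one: "\<Delta> 1 = \<one>\<^bsub>tensor_ring s t\<^esub>"
    and comult_bimodule: "\<Delta> (t a * h * s b) = tensor_biaction s t a (\<Delta> h) b"
    and counit_morphism: "algebra_morphism scH scA \<epsilon>"
    and counit_bimodule: "\<epsilon> (t a * h * s b) = a * \<epsilon> h * b"
    and coassoc: "comult_tensor_id s t \<Delta> (\<Delta> h) = id_tensor_comult s t \<Delta> (\<Delta> h)"
    and counit_left: "tensor_eval scH (\<lambda>(x, y). t (\<epsilon> x) * y) (\<Delta> h) = h"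
    and counit_right: "tensor_eval scH (\<lambda>(x, y). x * s (\<epsilon> y)) (\<Delta> h) = h"
    and antipode_morphism: "algebra_morphism scH scH S"
    and antipode_source: "S (s a) = t a"
    and antipode_target: "S (t a) = s a"
    and antipode_left: "tensor_eval scH (\<lambda>(x, y). S x * y) (\<Delta> h) = s (\<epsilon> h)"
    and antipode_right: "tensor_eval scH (\<lambda>(x, y). x * S y) (\<Delta> h) = t (\<epsilon> h)"


section \<open>Local biretractions and convolution\<close>

definition local_biretraction ::
  "('k::field \<Rightarrow> 'h::{comm_ring, comm_monoid_mult} \<Rightarrow> 'h) \<Rightarrow>
   ('k \<Rightarrow> 'a::{comm_ring, comm_monoid_mult} \<Rightarrow> 'a) \<Rightarrow>
   ('a \<Rightarrow> 'h) \<Rightarrow> ('a \<Rightarrow> 'h) \<Rightarrow> ('h \<Rightarrow> 'a) \<Rightarrow> bool" where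
  "local_biretraction scH scA s t \<alpha> \<longleftrightarrow>
     Vector_Spaces.linear scH scA \<alpha> \<and>
     (\<forall>h k. \<alpha> (h * k) = \<alpha> h * \<alpha> k) \<and>
     (\<forall>a. \<alpha> (s a) = a * \<alpha> 1) \<and>
     (\<exists>e. \<alpha> (t e) = \<alpha> 1 \<and>
          bij_betw (\<lambda>a. \<alpha> (t a)) (range (\<lambda>a. a * e)) (range (\<lambda>a. a * \<alpha> 1)))"

definition Brt ::
  "('k::field \<Rightarrow> 'h::{comm_ring, comm_monoid_mult} \<Rightarrow> 'h) \<Rightarrow>
   ('k \<Rightarrow> 'a::{comm_ring, comm_monoid_mult} \<Rightarrow> 'a) \<Rightarrow>
   ('a \<Rightarrow> 'h) \<Rightarrow> ('a \<Rightarrow> 'h) \<Rightarrow> ('h \<Rightarrow> 'a) set" where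
  "Brt scH scA s t = {\<alpha>. local_biretraction scH scA s t \<alpha>}"

definition convolution ::
  "('k::field \<Rightarrow> 'a::{comm_ring, comm_monoid_mult} \<Rightarrow> 'a) \<Rightarrow>
   ('a \<Rightarrow> 'h::{comm_ring, comm_monoid_mult}) \<Rightarrow> ('h \<Rightarrow> ('h \<times> 'h \<Rightarrow>\<^sub>0 int) set) \<Rightarrow>
   ('h \<Rightarrow> 'a) \<Rightarrow> ('h \<Rightarrow> 'a) \<Rightarrow> 'h \<Rightarrow> 'a" where
  "convolution scA t \<Delta> \<alpha> \<beta> h = tensor_eval scA (\<lambda>(x, y). \<beta> (t (\<alpha> x) * y)) (\<Delta> h)"

definition regular_monoid :: "('m, 'b) monoid_scheme \<Rightarrow> bool" where
  "regular_monoid M \<longleftrightarrow> monoid M \<and>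
     (\<forall>x\<in>carrier M. \<exists>y\<in>carrier M.
        x \<otimes>\<^bsub>M\<^esub> y \<otimes>\<^bsub>M\<^esub> x = x \<and> y \<otimes>\<^bsub>M\<^esub> x \<otimes>\<^bsub>M\<^esub> y = y)"

end

theory Submission
  imports Defs
begin

text \<open>
  A local biretraction \<open>\<alpha>\<close> is controlled by the endomap \<open>\<alpha> \<circ> t\<close> of the base algebra.  On
  elements \<open>t a\<close> the convolution is composition: \<open>(\<alpha> * \<beta>) \<circ> t = (\<beta> \<circ> t) \<circ> (\<alpha> \<circ> t)\<close>.  Condition
  (BRT2) speaks only of this endomap, and it says that \<open>\<alpha> \<circ> t\<close> is a multiplicative map which
  induces an isomorphism from a corner \<open>A e\<close> onto the corner \<open>A (\<alpha> 1)\<close>.  This is equivalent to the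
  existence of a multiplicative map \<open>g\<close> in the other direction such that \<open>g \<circ> \<alpha> \<circ> t\<close> and
  \<open>\<alpha> \<circ> t \<circ> g\<close> are the multiplications by the idempotents \<open>g 1\<close> and \<open>\<alpha> 1\<close>
  (\<open>corner_bijection_iff\<close>).  In this form (BRT2) is symmetric in \<open>\<alpha> \<circ> t\<close> and \<open>g\<close> and evidently
  closed under composition.

  The monoid laws are then Sweedler calculus.  Both
  \<open>((\<alpha> * \<beta>) * \<gamma>)(h)\<close> and \<open>(\<alpha> * (\<beta> * \<gamma>))(h)\<close> equal
  \<open>\<gamma>(t(\<beta>(t(\<alpha>(h\<^sub>1))))) \<gamma>(t(\<beta>(h\<^sub>2))) \<gamma>(h\<^sub>3)\<close>, and the counit is the unit.  To make such computations
  formal, every value \<open>f(h\<^sub>1, h\<^sub>2)\<close> is computed from an arbitrary representative of \<open>\<Delta> h\<close>; this is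
  legitimate because \<open>f\<close> vanishes on the relators of the tensor product.

  The pseudo-inverse of \<open>\<alpha>\<close> is \<open>\<alpha>\<^sup>\<star> = g \<circ> \<alpha> \<circ> S\<close>.  It satisfies \<open>\<alpha>\<^sup>\<star> \<circ> t = g\<close>, so it is again a local
  biretraction by the symmetry above.  The antipode axioms give \<open>(\<alpha> * \<alpha>\<^sup>\<star>)(h) = \<epsilon>(h) g(1)\<close> and
  \<open>(\<alpha>\<^sup>\<star> * \<alpha>)(h) = \<epsilon>(h) \<alpha>(1)\<close>, and these multiples of the counit act as left units on \<open>\<alpha>\<close> and on
  \<open>\<alpha>\<^sup>\<star>\<close> respectively (\<open>conv_counit_multiple_left\<close>).
\<close>

section \<open>Evaluating formal sums and tensors\<close>

lemma (in vector_space) frag_sum_superset: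
  assumes "finite K" "Poly_Mapping.keys c \<subseteq> K"
  shows "frag_sum scale f c = (\<Sum>p\<in>K. scale (of_int (Poly_Mapping.lookup c p)) (f p))"
  unfolding frag_sum_def
  by (rule sum.mono_neutral_left) (use assms in \<open>auto simp: in_keys_iff\<close>)

lemma (in vector_space) frag_sum_frag_of [simp]: "frag_sum scale f (frag_of p) = f p"
  by (simp add: frag_sum_def)

lemma (in vector_space) frag_sum_zero [simp]: "frag_sum scale f 0 = 0"
  by (simp add: frag_sum_def)

lemma (in vector_space) frag_sum_diff [simp]:
  "frag_sum scale f (c - d) = frag_sum scale f c - frag_sum scale f d"
proof -
  let ?K = "Poly_Mapping.keys c \<union> Poly_Mapping.keys d"
  have "Poly_Mapping.keys (c - d) \<subseteq> ?K" by (rule keys_diff)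
  then show ?thesis
    by (simp add: frag_sum_superset[of ?K] lookup_minus scale_left_diff_distrib sum_subtractf)
qed

lemma (in vector_space) frag_sum_add [simp]:
  "frag_sum scale f (c + d) = frag_sum scale f c + frag_sum scale f d"
  using frag_sum_diff[of f "c + d" d] by (simp add: algebra_simps)

lemma (in vector_space) frag_sum_frag_extend:
  "frag_sum scale f (frag_extend g c) = frag_sum scale (\<lambda>p. frag_sum scale f (g p)) c"
  by (induction c rule: frag_induction[OF subset_UNIV]) (simp_all add: frag_extend_diff)

lemma linear_frag_sum:
  assumes "Vector_Spaces.linear sc1 sc2 T"
  shows "T (frag_sum sc1 f c) = frag_sum sc2 (\<lambda>p. T (f p)) c"
proof -
  interpret Vector_Spaces.linear sc1 sc2 T by fact
  show ?thesis by (simp add: frag_sum_def sum scale)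
qed

lemma (in comm_algebra) linear_mult_right: "Vector_Spaces.linear scale scale (\<lambda>x. x * z)"
  by unfold_locales (simp_all add: distrib_right scale_mult_left)

lemma (in comm_algebra) frag_sum_mult_right:
  "frag_sum scale f c * z = frag_sum scale (\<lambda>p. f p * z) c"
  by (rule linear_frag_sum[OF linear_mult_right])

lemma (in comm_algebra) frag_sum_mult_left:
  "z * frag_sum scale f c = frag_sum scale (\<lambda>p. z * f p) c"
  by (simp add: mult.commute[of z] frag_sum_mult_right)

lemma (in comm_algebra) frag_sum_frag_pair_mult:
  assumes "\<And>x y u v. f (x * u, y * v) = f (x, y) * f (u, v)"
  shows "frag_sum scale f (frag_pair_mult c d) = frag_sum scale f c * frag_sum scale f d"
  by (simp add: frag_pair_mult_def frag_sum_frag_extend split_def assms frag_sum_mult_right)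
    (simp add: frag_sum_mult_left)

lemma mem_free_class_iff:
  "d \<in> free_class R c \<longleftrightarrow> d - c \<in> generate (free_Abelian_group UNIV) R"
  by (auto simp: free_class_def r_coset_def algebra_simps)
     (metis add.commute diff_add_cancel)+

lemma self_mem_free_class: "c \<in> free_class R c"
  using generate.one[of "free_Abelian_group UNIV" R] by (simp add: mem_free_class_iff)

lemma (in vector_space) frag_sum_eq_if_mem_free_class:
  assumes "d \<in> free_class R c" and "\<And>r. r \<in> R \<Longrightarrow> frag_sum scale f r = 0"
  shows "frag_sum scale f d = frag_sum scale f c"
proof -
  have "frag_sum scale f z = 0" if "z \<in> generate (free_Abelian_group UNIV) R" for z
    using that
  proof induction
    case (inv h)
    have "inv\<^bsub>free_Abelian_group UNIV\<^esub> h = 0 - h" by simp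
    with inv assms(2) show ?case by (simp only: frag_sum_diff frag_sum_zero diff_self)
  qed (use assms(2) in auto)
  from this[of "d - c"] assms(1) have "frag_sum scale f (d - c) = 0"
    by (simp only: mem_free_class_iff)
  then show ?thesis by simp
qed

text \<open>The maps that factor through the tensor product over the base algebra.\<close>

definition balanced ::
  "('a \<Rightarrow> 'h::{comm_ring, comm_monoid_mult}) \<Rightarrow> ('a \<Rightarrow> 'h) \<Rightarrow> ('h \<times> 'h \<Rightarrow> 'b::ab_group_add) \<Rightarrow> bool"
  where "balanced s t f \<longleftrightarrow>
     (\<forall>x x' y. f (x + x', y) = f (x, y) + f (x', y)) \<and>
     (\<forall>x y y'. f (x, y + y') = f (x, y) + f (x, y')) \<and>
     (\<forall>x a y. f (x * s a, y) = f (x, t a * y))"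

lemma (in vector_space) tensor_eval_free_class:
  assumes "balanced s t f" and "c \<in> tensor2_class s t d"
  shows "tensor_eval scale f (tensor2_class s t d) = frag_sum scale f c"
proof -
  have "frag_sum scale f r = 0" if "r \<in> tensor2_relators s t" for r
    using that assms(1) by (auto simp: tensor2_relators_def balanced_def)
  then have "frag_sum scale f c' = frag_sum scale f d" if "c' \<in> tensor2_class s t d" for c'
    using that by (rule frag_sum_eq_if_mem_free_class[rotated])
  with assms(2) have "frag_sum scale f ` tensor2_class s t d = {frag_sum scale f c}" by auto
  then show ?thesis by (simp add: tensor_eval_def)
qed

section \<open>Multiplicative maps that restrict to isomorphisms of corners\<close>

text \<open>
  Neither map need preserve \<open>1\<close>: the images \<open>f 1\<close> and \<open>g 1\<close> are idempotents, and \<open>f\<close> and \<open>g\<close>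
  restrict to mutually inverse isomorphisms between the corners that they generate, each map being
  multiplication by the idempotent followed by that isomorphism.
\<close>

definition corner_inverses ::
  "('a::comm_monoid_mult \<Rightarrow> 'b::comm_monoid_mult) \<Rightarrow> ('b \<Rightarrow> 'a) \<Rightarrow> bool" where
  "corner_inverses f g \<longleftrightarrow>
     (\<forall>a b. f (a * b) = f a * f b) \<and> (\<forall>a b. g (a * b) = g a * g b) \<and>
     (\<forall>a. g (f a) = a * g 1) \<and> (\<forall>b. f (g b) = b * f 1)"

lemma corner_inversesD:
  assumes "corner_inverses f g"
  shows "f (a * b) = f a * f b" "g (c * d) = g c * g d" "g (f a) = a * g 1" "f (g c) = c * f 1"
  using assms by (simp_all add: corner_inverses_def)

lemma mult_map_one:
  fixes f :: "'a::comm_monoid_mult \<Rightarrow> 'b::comm_monoid_mult"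
  assumes "\<And>a b. f (a * b) = f a * f b"
  shows "f a * f 1 = f a"
  using assms[of a 1] by simp

lemma corner_inverses_sym: "corner_inverses f g \<Longrightarrow> corner_inverses g f"
  by (simp add: corner_inverses_def)

lemma corner_inverses_comp:
  assumes "corner_inverses f g" and "corner_inverses f' g'"
  shows "corner_inverses (\<lambda>a. f' (f a)) (\<lambda>b. g (g' b))"
proof -
  note f = corner_inversesD[OF assms(1)] and f' = corner_inversesD[OF assms(2)]
  have "g 1 * g b = g b" "f' 1 * f' b' = f' b'" for b b'
    using mult_map_one[of g b] mult_map_one[of f' b'] f f' by (simp_all add: mult.commute)
  then show ?thesis
    by (simp add: corner_inverses_def f f' mult.assoc)
qed

text \<open>
  From left to right, injectivity on the corner of \<open>e\<close> forces \<open>e\<close> to be idempotent, since \<open>e * e\<close> and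
  \<open>e\<close> have the same image.  Hence the value \<open>g b\<close> can be taken as the unique element of that corner
  which \<open>f\<close> sends to \<open>b * f 1\<close>, and uniqueness makes \<open>g\<close> multiplicative.
\<close>

lemma corner_bijection_iff:
  fixes f :: "'a::comm_monoid_mult \<Rightarrow> 'b::comm_monoid_mult"
  assumes f: "\<And>a b. f (a * b) = f a * f b"
  shows "(\<exists>e. f e = f 1 \<and> bij_betw f (range (\<lambda>a. a * e)) (range (\<lambda>b. b * f 1))) \<longleftrightarrow>
         (\<exists>g. corner_inverses f g)" (is "?L \<longleftrightarrow> ?R")
proof
  assume ?L
  then obtain e where e: "f e = f 1"
    and bij: "bij_betw f (range (\<lambda>a. a * e)) (range (\<lambda>b. b * f 1))" by blast
  have f1: "f a * f 1 = f a" for a by (rule mult_map_one) (rule f)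
  have inj: "a * e = b * e" if "f (a * e) = f (b * e)" for a b
    using bij_betw_imp_inj_on[OF bij] that by (auto dest: inj_onD)
  have idem: "e * e = e"
    using inj[of e 1] by (simp add: f e f1)
  have "\<exists>x. f (x * e) = b * f 1" for b
  proof -
    have "b * f 1 \<in> f ` range (\<lambda>a. a * e)"
      using bij_betw_imp_surj_on[OF bij] by auto
    then show ?thesis by (auto intro: sym)
  qed
  then obtain k where k: "f (k b * e) = b * f 1" for b by metis
  define g where "g b = k b * e" for b
  have fg: "f (g b) = b * f 1" for b by (simp add: g_def k)
  have ge: "g b * e = g b" for b by (simp add: g_def mult.assoc idem)
  have g_eqI: "g b = x * e" if "f x = b * f 1" for b x
  proof -
    have "f (g b * e) = f (x * e)" by (simp add: f fg that e)
    from inj[OF this] show ?thesis by (simp add: ge)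
  qed
  have g1: "g 1 = e" using g_eqI[of 1 1] by simp
  have "g (a * b) = g a * g b" for a b
  proof -
    have "f (g a * g b) = (a * b) * f 1"
      by (simp add: f fg f1 mult.assoc mult.left_commute)
    from g_eqI[OF this] show ?thesis by (simp add: mult.assoc ge)
  qed
  moreover have "g (f a) = a * g 1" for a
    using g_eqI[of a "f a"] by (simp add: f1 g1)
  ultimately have "corner_inverses f g"
    by (simp add: corner_inverses_def f fg)
  then show ?R by blast
next
  assume ?R
  then obtain g where "corner_inverses f g" ..
  note g = corner_inversesD[OF this]
  have g1: "g b * g 1 = g b" for b by (rule mult_map_one) (rule g)
  have "bij_betw f (range (\<lambda>a. a * g 1)) (range (\<lambda>b. b * f 1))"
  proof (rule bij_betw_byWitness[where f' = g])
    show "\<forall>a\<in>range (\<lambda>a. a * g 1). g (f a) = a" by (auto simp: g(3) mult.assoc g1)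
    show "\<forall>b\<in>range (\<lambda>b. b * f 1). f (g b) = b"
      using mult_map_one[of f 1] by (auto simp: g(4) mult.assoc f)
    show "f ` range (\<lambda>a. a * g 1) \<subseteq> range (\<lambda>b. b * f 1)" by (auto simp: f g(4))
    show "g ` range (\<lambda>b. b * f 1) \<subseteq> range (\<lambda>a. a * g 1)" by (auto simp: g(2,3))
  qed
  moreover have "f (g 1) = f 1" by (simp add: g(4))
  ultimately show ?L by blast
qed

text \<open>Again \<open>g b\<close> is determined by its image under \<open>f\<close> within the corner of \<open>g 1\<close>.\<close>

lemma corner_inverses_linear:
  fixes f :: "'a::{comm_ring, comm_monoid_mult} \<Rightarrow> 'b::{comm_ring, comm_monoid_mult}"
  assumes fg: "corner_inverses f g"
    and A: "comm_algebra scA" and B: "comm_algebra scB"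
    and lin: "Vector_Spaces.linear scA scB f"
  shows "Vector_Spaces.linear scB scA g"
proof -
  interpret A: comm_algebra scA by fact
  interpret B: comm_algebra scB by fact
  interpret f: Vector_Spaces.linear scA scB f by fact
  note D = corner_inversesD[OF fg]
  have g1: "g b * g 1 = g b" for b by (rule mult_map_one) (rule D)
  have eqI: "g b = x" if "f x = b * f 1" "x * g 1 = x" for b x
  proof -
    have "g b = g (b * f 1)" by (simp add: D(2,3) g1)
    also have "\<dots> = x" by (simp add: D(3) that(2) flip: that(1))
    finally show ?thesis .
  qed
  show ?thesis
  proof unfold_locales
    show "g (b + b') = g b + g b'" for b b'
      by (rule eqI) (simp_all add: f.add D(4) distrib_right g1)
    show "g (scB r b) = scA r (g b)" for r b
      by (rule eqI) (simp_all add: f.scale D(4) g1 flip: A.scale_mult_left B.scale_mult_left)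
  qed
qed

section \<open>Calculus of the comultiplication\<close>

context comm_hopf_algebroid
begin

lemma source_simps: "s (a + b) = s a + s b" "s (a * b) = s a * s b" "s 1 = 1"
  and target_simps: "t (a + b) = t a + t b" "t (a * b) = t a * t b" "t 1 = 1"
  and counit_simps: "\<epsilon> (h + k) = \<epsilon> h + \<epsilon> k" "\<epsilon> (h * k) = \<epsilon> h * \<epsilon> k" "\<epsilon> 1 = 1"
  and antipode_simps: "S (h + k) = S h + S k" "S (h * k) = S h * S k" "S 1 = 1"
  using source_morphism target_morphism counit_morphism antipode_morphism
  unfolding algebra_morphism_def Vector_Spaces.linear_def module_hom_def module_hom_axioms_def
  by auto

lemma counit_source [simp]: "\<epsilon> (s a) = a" and counit_target [simp]: "\<epsilon> (t a) = a"
  using counit_bimodule[of 1 1 a] counit_bimodule[of a 1 1]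
  by (simp_all add: source_simps target_simps counit_simps)

lemma comult_eq_tensor2_class: "\<exists>d. \<Delta> h = tensor2_class s t d"
  using comult_closed[of h]
  by (auto simp: tensor_ring_def Let_def FactGroup_def RCOSETS_def free_class_def)

lemma comult_nonempty: "\<exists>c. c \<in> \<Delta> h"
  using comult_eq_tensor2_class[of h] self_mem_free_class by metis

text \<open>
  Sweedler notation is justified here: a balanced expression in \<open>h\<^sub>1\<close> and \<open>h\<^sub>2\<close> may be computed from any
  representative of \<open>\<Delta> h\<close>.  The membership lemmas that follow turn the axioms on \<open>\<Delta>\<close>, which are
  equations between cosets, into convenient choices of representatives.
\<close>

lemma tensor_eval_comult:
  assumes "vector_space sc" "balanced s t f" "c \<in> \<Delta> h"
  shows "tensor_eval sc f (\<Delta> h) = frag_sum sc f c"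
  using vector_space.tensor_eval_free_class[OF assms(1,2)] comult_eq_tensor2_class[of h] assms(3)
  by metis

lemma add_mem_comult: "c \<in> \<Delta> h \<Longrightarrow> d \<in> \<Delta> k \<Longrightarrow> c + d \<in> \<Delta> (h + k)"
  by (force simp: comult_add tensor_ring_def Let_def FactGroup_def set_mult_def)

lemma frag_pair_mult_mem_comult:
  "c \<in> \<Delta> h \<Longrightarrow> d \<in> \<Delta> k \<Longrightarrow> frag_pair_mult c d \<in> \<Delta> (h * k)"
  using self_mem_free_class by (force simp: comult_mult tensor_ring_def Let_def)

lemma one_mem_comult: "frag_of (1, 1) \<in> \<Delta> 1"
  using self_mem_free_class by (simp add: comult_one tensor_ring_def Let_def)

lemma biaction_mem_comult:
  "c \<in> \<Delta> h \<Longrightarrow> frag_extend (\<lambda>(x, y). frag_of (t a * x, y * s b)) c \<in> \<Delta> (t a * h * s b)"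
  using self_mem_free_class by (force simp: comult_bimodule tensor_biaction_def)

lemma source_mem_comult: "frag_of (1, s a) \<in> \<Delta> (s a)"
  and target_mem_comult: "frag_of (t a, 1) \<in> \<Delta> (t a)"
  using biaction_mem_comult[OF one_mem_comult, of 1 a] biaction_mem_comult[OF one_mem_comult, of a 1]
  by (simp_all add: source_simps target_simps)

lemma counit_left_frag_sum:
  assumes "c \<in> \<Delta> h" shows "frag_sum scH (\<lambda>(x, y). t (\<epsilon> x) * y) c = h"
proof -
  have "balanced s t (\<lambda>(x, y). t (\<epsilon> x) * y)"
    by (simp add: balanced_def target_simps counit_simps algebra_simps)
  from tensor_eval_comult[OF H.vector_space_axioms this assms] show ?thesis
    by (simp add: counit_left)
qed

lemma counit_right_frag_sum:
  assumes "c \<in> \<Delta> h" shows "frag_sum scH (\<lambda>(x, y). x * s (\<epsilon> y)) c = h"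
proof -
  have "balanced s t (\<lambda>(x, y). x * s (\<epsilon> y))"
    by (simp add: balanced_def source_simps counit_simps algebra_simps)
  from tensor_eval_comult[OF H.vector_space_axioms this assms] show ?thesis
    by (simp add: counit_right)
qed

lemma antipode_left_frag_sum:
  assumes "c \<in> \<Delta> h" shows "frag_sum scH (\<lambda>(x, y). S x * y) c = s (\<epsilon> h)"
proof -
  have "balanced s t (\<lambda>(x, y). S x * y)"
    by (simp add: balanced_def antipode_simps antipode_source algebra_simps)
  from tensor_eval_comult[OF H.vector_space_axioms this assms] show ?thesis
    by (simp add: antipode_left)
qed

lemma antipode_right_frag_sum:
  assumes "c \<in> \<Delta> h" shows "frag_sum scH (\<lambda>(x, y). x * S y) c = t (\<epsilon> h)"
proof -
  have "balanced s t (\<lambda>(x, y). x * S y)"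
    by (simp add: balanced_def antipode_simps antipode_target algebra_simps)
  from tensor_eval_comult[OF H.vector_space_axioms this assms] show ?thesis
    by (simp add: antipode_right)
qed

section \<open>Convolution of local retractions\<close>

text \<open>
  Multiplicative linear maps with (BRT1) are separated from (BRT2) because Sweedler calculus deals
  with them, while (BRT2) is a property of \<open>\<alpha> \<circ> t\<close> alone and is left to corner inverses.
\<close>

definition local_retraction :: "('h \<Rightarrow> 'a) \<Rightarrow> bool" where
  "local_retraction \<alpha> \<longleftrightarrow> Vector_Spaces.linear scH scA \<alpha> \<and>
     (\<forall>h k. \<alpha> (h * k) = \<alpha> h * \<alpha> k) \<and> (\<forall>a. \<alpha> (s a) = a * \<alpha> 1)"

lemma local_retractionD:
  assumes "local_retraction \<alpha>"
  shows "Vector_Spaces.linear scH scA \<alpha>" "\<alpha> (h * k) = \<alpha> h * \<alpha> k" "\<alpha> (s a) = a * \<alpha> 1"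
    "\<alpha> (h + k) = \<alpha> h + \<alpha> k" "\<alpha> (scH r h) = scA r (\<alpha> h)" "\<alpha> h * \<alpha> 1 = \<alpha> h"
    "\<alpha> (h * s a) = \<alpha> h * a"
proof -
  show "Vector_Spaces.linear scH scA \<alpha>" and "\<alpha> (h * k) = \<alpha> h * \<alpha> k" and "\<alpha> (s a) = a * \<alpha> 1"
    using assms by (simp_all add: local_retraction_def)
  interpret Vector_Spaces.linear scH scA \<alpha> by fact
  show "\<alpha> (h + k) = \<alpha> h + \<alpha> k" "\<alpha> (scH r h) = scA r (\<alpha> h)" by (rule add, rule scale)
  show one: "\<alpha> h * \<alpha> 1 = \<alpha> h"
    by (rule mult_map_one) (use assms in \<open>simp add: local_retraction_def\<close>)
  have "\<alpha> (h * s a) = (\<alpha> h * \<alpha> 1) * a"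
    using assms by (simp add: local_retraction_def mult_ac del: mult_1_left mult_1_right)
  then show "\<alpha> (h * s a) = \<alpha> h * a" by (simp only: one)
qed

lemma Brt_iff:
  "\<alpha> \<in> Brt scH scA s t \<longleftrightarrow> local_retraction \<alpha> \<and> (\<exists>g. corner_inverses (\<lambda>a. \<alpha> (t a)) g)"
proof (cases "local_retraction \<alpha>")
  case True
  have "(\<lambda>a. \<alpha> (t a)) (a * b) = (\<lambda>a. \<alpha> (t a)) a * (\<lambda>a. \<alpha> (t a)) b" for a b
    by (simp add: target_simps local_retractionD(2)[OF True])
  from corner_bijection_iff[of "\<lambda>a. \<alpha> (t a)", OF this] True show ?thesis
    by (simp add: Brt_def local_biretraction_def local_retraction_def target_simps)
qed (auto simp: Brt_def local_biretraction_def local_retraction_def)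

abbreviation conv :: "('h \<Rightarrow> 'a) \<Rightarrow> ('h \<Rightarrow> 'a) \<Rightarrow> 'h \<Rightarrow> 'a" where
  "conv \<equiv> convolution scA t \<Delta>"

text \<open>
  The integrand is balanced because \<open>\<alpha> (x * s a) = \<alpha> x * a\<close>, so that both sides of the tensor relator
  acquire the same factor \<open>\<beta> (t a)\<close>.
\<close>

lemma conv_eq_frag_sum:
  assumes \<alpha>: "local_retraction \<alpha>" and \<beta>: "local_retraction \<beta>" and c: "c \<in> \<Delta> h"
  shows "conv \<alpha> \<beta> h = frag_sum scA (\<lambda>(x, y). \<beta> (t (\<alpha> x)) * \<beta> y) c"
proof -
  note a = local_retractionD[OF \<alpha>] and b = local_retractionD[OF \<beta>]
  have eq: "(\<lambda>(x, y). \<beta> (t (\<alpha> x) * y)) = (\<lambda>(x, y). \<beta> (t (\<alpha> x)) * \<beta> y)" by (simp add: b)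
  have "balanced s t (\<lambda>(x, y). \<beta> (t (\<alpha> x)) * \<beta> y)"
    by (simp add: balanced_def a(4,7) b(2,4) target_simps distrib_left distrib_right mult.assoc)
  from tensor_eval_comult[OF A.vector_space_axioms this c] show ?thesis
    by (simp add: convolution_def eq)
qed

lemma conv_target:
  assumes "local_retraction \<alpha>" and "local_retraction \<beta>"
  shows "conv \<alpha> \<beta> (t a) = \<beta> (t (\<alpha> (t a)))"
  by (simp add: conv_eq_frag_sum[OF assms target_mem_comult] local_retractionD(6)[OF assms(2)])

lemma local_retraction_conv:
  assumes \<alpha>: "local_retraction \<alpha>" and \<beta>: "local_retraction \<beta>"
  shows "local_retraction (conv \<alpha> \<beta>)"
proof -
  note a = local_retractionD[OF \<alpha>] and b = local_retractionD[OF \<beta>]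
    and conv = conv_eq_frag_sum[OF \<alpha> \<beta>]
  have "conv \<alpha> \<beta> (h + k) = conv \<alpha> \<beta> h + conv \<alpha> \<beta> k" for h k
  proof -
    obtain c d where cd: "c \<in> \<Delta> h" "d \<in> \<Delta> k" using comult_nonempty by metis
    show ?thesis by (simp add: conv[OF cd(1)] conv[OF cd(2)] conv[OF add_mem_comult[OF cd]])
  qed
  moreover have "conv \<alpha> \<beta> (scH r h) = scA r (conv \<alpha> \<beta> h)" for r h
  proof -
    obtain c where c: "c \<in> \<Delta> h" using comult_nonempty by metis
    interpret t: Vector_Spaces.linear scA scH t
      using target_morphism by (simp add: algebra_morphism_def)
    have tr: "t (scA r 1) * y = scH r y" for y
      by (simp add: t.scale target_simps flip: H.scale_mult_left)
    \<comment> \<open>Scalars act through the base algebra, so linearity is a case of the bimodule axiom.\<close>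
    have "scH r h = t (scA r 1) * h * s 1" by (simp add: tr source_simps)
    then have "conv \<alpha> \<beta> (scH r h) = conv \<alpha> \<beta> (t (scA r 1) * h * s 1)" by (simp only:)
    also have "\<dots> =
        frag_sum scA (\<lambda>(x, y). scA r (\<beta> (t (\<alpha> x)) * \<beta> y)) c"
      unfolding conv[OF biaction_mem_comult[OF c]]
      by (simp only: A.frag_sum_frag_extend split_def tr source_simps mult_1_right
          A.frag_sum_frag_of fst_conv snd_conv a(5) b(5) t.scale[of r "\<alpha> _"] A.scale_mult_left)
    also have "\<dots> = scA r (conv \<alpha> \<beta> h)"
      by (simp add: conv[OF c] split_def linear_frag_sum[OF A.linear_scale_self])
    finally show ?thesis .
  qed
  ultimately have "Vector_Spaces.linear scH scA (conv \<alpha> \<beta>)" by unfold_locales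
  moreover have "conv \<alpha> \<beta> (h * k) = conv \<alpha> \<beta> h * conv \<alpha> \<beta> k" for h k
  proof -
    obtain c d where cd: "c \<in> \<Delta> h" "d \<in> \<Delta> k" using comult_nonempty by metis
    have "frag_sum scA (\<lambda>(x, y). \<beta> (t (\<alpha> x)) * \<beta> y) (frag_pair_mult c d) =
      frag_sum scA (\<lambda>(x, y). \<beta> (t (\<alpha> x)) * \<beta> y) c * frag_sum scA (\<lambda>(x, y). \<beta> (t (\<alpha> x)) * \<beta> y) d"
      by (rule A.frag_sum_frag_pair_mult)
        (simp add: a(2) b(2) target_simps mult.assoc mult.left_commute)
    then show ?thesis
      by (simp add: conv[OF cd(1)] conv[OF cd(2)] conv[OF frag_pair_mult_mem_comult[OF cd]])
  qed
  moreover have "conv \<alpha> \<beta> (s a) = a * conv \<alpha> \<beta> 1" for a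
    by (simp add: conv[OF source_mem_comult] conv[OF one_mem_comult] b(3) mult.left_commute)
  ultimately show ?thesis by (simp add: local_retraction_def)
qed

text \<open>
  Both sides are values of the balanced trilinear map \<open>G\<close> below, at \<open>(\<Delta> \<otimes> id) (\<Delta> h)\<close> and at
  \<open>(id \<otimes> \<Delta>) (\<Delta> h)\<close>.
\<close>

lemma conv_assoc:
  assumes \<alpha>: "local_retraction \<alpha>" and \<beta>: "local_retraction \<beta>" and \<gamma>: "local_retraction \<gamma>"
  shows "conv (conv \<alpha> \<beta>) \<gamma> = conv \<alpha> (conv \<beta> \<gamma>)"
proof
  fix h
  note a = local_retractionD[OF \<alpha>] and b = local_retractionD[OF \<beta>]
    and g = local_retractionD[OF \<gamma>]
  define G where "G = (\<lambda>(x, y, z). \<gamma> (t (\<beta> (t (\<alpha> x)))) * \<gamma> (t (\<beta> y)) * \<gamma> z)"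
  have G_relators: "frag_sum scA G r = 0" if "r \<in> tensor3_relators s t" for r
    using that unfolding tensor3_relators_def G_def
    by (auto simp: a(4,7) b(4,7) b(2)[of "t _"] g(2,4) target_simps distrib_left distrib_right
        mult.assoc)
  obtain r where r: "r k \<in> \<Delta> k" for k using comult_nonempty by metis
  obtain c where c: "c \<in> \<Delta> h" using comult_nonempty by metis
  define E where "E = frag_extend (\<lambda>(x, y). frag_extend (\<lambda>(u, v). frag_of (u, v, y)) (r x)) c"
  have "E \<in> comult_tensor_id s t \<Delta> (\<Delta> h)"
    using c r self_mem_free_class unfolding comult_tensor_id_def E_def by blast
  \<comment> \<open>Coassociativity equates unions of cosets, so \<open>E\<close> lies in a coset given by
    another choice of representatives, whence the new \<open>c'\<close> and \<open>r'\<close>.\<close>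
  then obtain c' r' where c': "c' \<in> \<Delta> h" and r': "r' k \<in> \<Delta> k" and
    E: "E \<in> tensor3_class s t
      (frag_extend (\<lambda>(x, y). frag_extend (\<lambda>(u, v). frag_of (x, u, v)) (r' y)) c')" for k
    unfolding coassoc id_tensor_comult_def by blast
  have "conv (conv \<alpha> \<beta>) \<gamma> h = frag_sum scA (\<lambda>(x, y). \<gamma> (t (conv \<alpha> \<beta> x)) * \<gamma> y) c"
    by (rule conv_eq_frag_sum[OF local_retraction_conv[OF \<alpha> \<beta>] \<gamma> c])
  also have "\<dots> = frag_sum scA G E"
  proof -
    have lin: "Vector_Spaces.linear scA scA (\<lambda>x. \<gamma> (t x) * \<gamma> y)" for y
    proof -
      have "Vector_Spaces.linear scA scA (\<lambda>x. \<gamma> (t x))"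
        using Vector_Spaces.linear_compose[OF _ g(1)] target_morphism
        by (auto simp: algebra_morphism_def o_def)
      from Vector_Spaces.linear_compose[OF this A.linear_mult_right] show ?thesis by (simp add: o_def)
    qed
    show ?thesis
      by (simp add: E_def A.frag_sum_frag_extend split_def conv_eq_frag_sum[OF \<alpha> \<beta> r]
          linear_frag_sum[OF lin] G_def target_simps g(2))
  qed
  also have "\<dots> = frag_sum scA G
      (frag_extend (\<lambda>(x, y). frag_extend (\<lambda>(u, v). frag_of (x, u, v)) (r' y)) c')"
    by (rule A.frag_sum_eq_if_mem_free_class[OF E G_relators])
  also have "\<dots> = frag_sum scA (\<lambda>(x, y). conv \<beta> \<gamma> (t (\<alpha> x)) * conv \<beta> \<gamma> y) c'"
    unfolding conv_target[OF \<beta> \<gamma>]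
    by (simp add: A.frag_sum_frag_extend split_def conv_eq_frag_sum[OF \<beta> \<gamma> r']
        A.frag_sum_mult_left G_def mult.assoc)
  also have "\<dots> = conv \<alpha> (conv \<beta> \<gamma>) h"
    by (rule conv_eq_frag_sum[OF \<alpha> local_retraction_conv[OF \<beta> \<gamma>] c', symmetric])
  finally show "conv (conv \<alpha> \<beta>) \<gamma> h = conv \<alpha> (conv \<beta> \<gamma>) h" .
qed

lemma local_retraction_counit: "local_retraction \<epsilon>"
  using counit_morphism by (simp add: local_retraction_def algebra_morphism_def)

text \<open>
  With \<open>e = 1\<close> this is the left unit law; the idempotents \<open>\<alpha> * \<alpha>\<^sup>\<star>\<close> and \<open>\<alpha>\<^sup>\<star> * \<alpha>\<close> formed with a
  pseudo-inverse are counit multiples too.  The factor \<open>t e\<close> disappears since \<open>\<alpha>\<close> cannot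
  distinguish it from \<open>1\<close>.
\<close>

lemma conv_counit_multiple_left:
  assumes \<alpha>: "local_retraction \<alpha>" and \<gamma>: "local_retraction \<gamma>"
    and eq: "\<And>h. \<gamma> h = \<epsilon> h * e" and e: "\<alpha> (t e) = \<alpha> 1"
  shows "conv \<gamma> \<alpha> = \<alpha>"
proof
  fix h
  note a = local_retractionD[OF \<alpha>]
  obtain c where c: "c \<in> \<Delta> h" using comult_nonempty by metis
  have "\<alpha> (t (\<gamma> x)) * \<alpha> y = \<alpha> (t (\<epsilon> x) * y)" for x y
    using a(6)[of "t (\<epsilon> x)"] by (simp add: eq target_simps a(2) e)
  then have "conv \<gamma> \<alpha> h = \<alpha> (frag_sum scH (\<lambda>(x, y). t (\<epsilon> x) * y) c)"
    by (simp add: conv_eq_frag_sum[OF \<gamma> \<alpha> c] linear_frag_sum[OF a(1)] split_def)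
  then show "conv \<gamma> \<alpha> h = \<alpha> h" by (simp add: counit_left_frag_sum[OF c])
qed

lemma conv_counit_right:
  assumes \<alpha>: "local_retraction \<alpha>"
  shows "conv \<alpha> \<epsilon> = \<alpha>"
proof
  fix h
  note a = local_retractionD[OF \<alpha>]
  obtain c where c: "c \<in> \<Delta> h" using comult_nonempty by metis
  have "\<epsilon> (t (\<alpha> x)) * \<epsilon> y = \<alpha> (x * s (\<epsilon> y))" for x y
    by (simp add: a(7))
  then have "conv \<alpha> \<epsilon> h = \<alpha> (frag_sum scH (\<lambda>(x, y). x * s (\<epsilon> y)) c)"
    by (simp add: conv_eq_frag_sum[OF \<alpha> local_retraction_counit c] linear_frag_sum[OF a(1)]
        split_def)
  then show "conv \<alpha> \<epsilon> h = \<alpha> h" by (simp add: counit_right_frag_sum[OF c])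
qed

section \<open>The regular monoid of local biretractions\<close>

lemma Brt_conv:
  assumes "\<alpha> \<in> Brt scH scA s t" and "\<beta> \<in> Brt scH scA s t"
  shows "conv \<alpha> \<beta> \<in> Brt scH scA s t"
proof -
  from assms obtain f g where r: "local_retraction \<alpha>" "local_retraction \<beta>"
    and "corner_inverses (\<lambda>a. \<alpha> (t a)) f" "corner_inverses (\<lambda>a. \<beta> (t a)) g"
    by (auto simp: Brt_iff)
  from corner_inverses_comp[OF this(3,4)] show ?thesis
    by (auto simp: Brt_iff local_retraction_conv[OF r] conv_target[OF r])
qed

lemma Brt_counit: "\<epsilon> \<in> Brt scH scA s t"
proof -
  have "corner_inverses (\<lambda>a. \<epsilon> (t a)) (\<lambda>a. a)" by (simp add: corner_inverses_def)
  then show ?thesis by (auto simp: Brt_iff local_retraction_counit)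
qed

text \<open>
  The pseudo-inverse is \<open>g \<circ> \<alpha> \<circ> S\<close>, where \<open>g\<close> inverts \<open>\<alpha> \<circ> t\<close> on corners.  The antipode exchanges
  source and target, so (BRT1) for it comes from \<open>g (\<alpha> (t a)) = a * g 1\<close>, while (BRT1) for \<open>\<alpha>\<close>
  shows that its composition with \<open>t\<close> is \<open>g\<close>.  The convolutions with \<open>\<alpha>\<close> collapse by
  the two antipode axioms.
\<close>

lemma Brt_pseudo_inverse:
  assumes "\<alpha> \<in> Brt scH scA s t"
  obtains \<beta> where "\<beta> \<in> Brt scH scA s t" "conv (conv \<alpha> \<beta>) \<alpha> = \<alpha>" "conv (conv \<beta> \<alpha>) \<beta> = \<beta>"
proof -
  from assms obtain g where \<alpha>: "local_retraction \<alpha>"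
    and corner: "corner_inverses (\<lambda>a. \<alpha> (t a)) g" by (auto simp: Brt_iff)
  note a = local_retractionD[OF \<alpha>] and cg = corner_inversesD[OF corner]
  have "Vector_Spaces.linear scA scA (\<lambda>a. \<alpha> (t a))"
    using Vector_Spaces.linear_compose[OF _ a(1)] target_morphism by (auto simp: algebra_morphism_def o_def)
  from corner_inverses_linear[OF corner A.comm_algebra_axioms A.comm_algebra_axioms this]
  have g_linear: "Vector_Spaces.linear scA scA g" .
  from Vector_Spaces.linear_compose[OF a(1) this] have g\<alpha>_linear: "Vector_Spaces.linear scH scA (\<lambda>h. g (\<alpha> h))"
    by (simp add: o_def)
  define \<beta> where "\<beta> h = g (\<alpha> (S h))" for h
  have g_\<alpha>_one: "g (\<alpha> 1) = g 1" using cg(3)[of 1] by (simp add: target_simps)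
  have \<beta>_one: "\<beta> 1 = g 1" by (simp add: \<beta>_def antipode_simps g_\<alpha>_one)
  have \<beta>_target: "\<beta> (t b) = g b" for b
    using mult_map_one[of g b] by (simp add: \<beta>_def antipode_target a(3) cg(2) g_\<alpha>_one)
  have "Vector_Spaces.linear scH scA \<beta>"
    using Vector_Spaces.linear_compose[OF _ g\<alpha>_linear] antipode_morphism
    by (auto simp: algebra_morphism_def o_def \<beta>_def[abs_def])
  then have \<beta>: "local_retraction \<beta>"
    by (simp add: local_retraction_def \<beta>_one)
      (simp add: \<beta>_def antipode_simps antipode_source a(2) cg(2,3))
  have \<beta>_mem: "\<beta> \<in> Brt scH scA s t"
    using corner_inverses_sym[OF corner] by (auto simp: Brt_iff \<beta> \<beta>_target)
  have \<alpha>\<beta>: "conv \<alpha> \<beta> h = \<epsilon> h * g 1" for h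
  proof -
    obtain c where c: "c \<in> \<Delta> h" using comult_nonempty by metis
    have "\<beta> (t (\<alpha> x)) * \<beta> y = g (\<alpha> (x * S y))" for x y
      by (simp add: \<beta>_target a(2) cg(2)) (simp add: \<beta>_def)
    then have "conv \<alpha> \<beta> h = g (\<alpha> (frag_sum scH (\<lambda>(x, y). x * S y) c))"
      by (simp add: conv_eq_frag_sum[OF \<alpha> \<beta> c] linear_frag_sum[OF g\<alpha>_linear] split_def)
    then show ?thesis by (simp add: antipode_right_frag_sum[OF c] cg(3))
  qed
  have \<beta>\<alpha>: "conv \<beta> \<alpha> h = \<epsilon> h * \<alpha> 1" for h
  proof -
    obtain c where c: "c \<in> \<Delta> h" using comult_nonempty by metis
    have "\<alpha> (t (\<beta> x)) * \<alpha> y = \<alpha> (S x * y)" for x y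
      by (simp add: \<beta>_def a(2,6) cg(4) target_simps)
    then have "conv \<beta> \<alpha> h = \<alpha> (frag_sum scH (\<lambda>(x, y). S x * y) c)"
      by (simp add: conv_eq_frag_sum[OF \<beta> \<alpha> c] linear_frag_sum[OF a(1)] split_def)
    then show ?thesis by (simp add: antipode_left_frag_sum[OF c] a(3))
  qed
  show thesis
  proof
    show "conv (conv \<alpha> \<beta>) \<alpha> = \<alpha>"
      by (rule conv_counit_multiple_left[OF \<alpha> local_retraction_conv[OF \<alpha> \<beta>] \<alpha>\<beta>])
        (simp add: cg(4) target_simps)
    show "conv (conv \<beta> \<alpha>) \<beta> = \<beta>"
      by (rule conv_counit_multiple_left[OF \<beta> local_retraction_conv[OF \<beta> \<alpha>] \<beta>\<alpha>])
        (simp add: \<beta>_target \<beta>_one g_\<alpha>_one)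
  qed (rule \<beta>_mem)
qed

theorem regular_monoid_Brt:
  "regular_monoid \<lparr>carrier = Brt scH scA s t, monoid.mult = conv, one = \<epsilon>\<rparr>" (is "regular_monoid ?M")
proof -
  have "monoid ?M"
    by (rule monoidI)
      (auto simp: Brt_conv Brt_counit conv_assoc conv_counit_right Brt_iff[THEN iffD1]
        intro!: conv_counit_multiple_left[OF _ local_retraction_counit, of _ 1]
        simp: target_simps)
  then show ?thesis
    unfolding regular_monoid_def using Brt_pseudo_inverse by simp metis
qed

end

theorem theorem4p7:
  fixes scH :: "'k::field_char_0 \<Rightarrow> 'h::{comm_ring, comm_monoid_mult} \<Rightarrow> 'h"
    and scA :: "'k \<Rightarrow> 'a::{comm_ring, comm_monoid_mult} \<Rightarrow> 'a"
    and s t :: "'a \<Rightarrow> 'h"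
    and \<Delta> :: "'h \<Rightarrow> ('h \<times> 'h \<Rightarrow>\<^sub>0 int) set"
    and \<epsilon> :: "'h \<Rightarrow> 'a"
    and S :: "'h \<Rightarrow> 'h"
  assumes "comm_hopf_algebroid scH scA s t \<Delta> \<epsilon> S"
  shows "(\<forall>\<alpha>\<in>Brt scH scA s t. \<forall>\<beta>\<in>Brt scH scA s t. \<forall>h. \<forall>c\<in>\<Delta> h.
            convolution scA t \<Delta> \<alpha> \<beta> h = frag_sum scA (\<lambda>(x, y). \<beta> (t (\<alpha> x) * y)) c \<and>
            convolution scA t \<Delta> \<alpha> \<beta> h = frag_sum scA (\<lambda>(x, y). \<beta> (t (\<alpha> x)) * \<beta> y) c) \<and>
         (\<exists>u. regular_monoid
                \<lparr>carrier = Brt scH scA s t, monoid.mult = convolution scA t \<Delta>, one = u\<rparr>)"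
proof -
  interpret comm_hopf_algebroid scH scA s t \<Delta> \<epsilon> S by fact
  have "conv \<alpha> \<beta> h = frag_sum scA (\<lambda>(x, y). \<beta> (t (\<alpha> x)) * \<beta> y) c \<and>
      (\<lambda>(x, y). \<beta> (t (\<alpha> x) * y)) = (\<lambda>(x, y). \<beta> (t (\<alpha> x)) * \<beta> y)"
    if "\<alpha> \<in> Brt scH scA s t" "\<beta> \<in> Brt scH scA s t" "c \<in> \<Delta> h" for \<alpha> \<beta> h c
    using that by (simp add: Brt_iff conv_eq_frag_sum local_retractionD(2))
  then show ?thesis using regular_monoid_Brt by metis
qed

end
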